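(* Let $D\subset\mathbf{R}^3$ be convex and let $f:D\rightarrow\mathbf{R}$ be a $C^{\infty}$ function. For $P\in D$ let $T(Hf)_P$ denote the quadratic form in $(x_1,x_2,x_3)\in\mathbf{R}^3$ $$T(Hf)_P=\sum_{i,k=1}^{3}\left(\frac{\partial^2 f}{\partial x_i\partial x_k}\right)_{P}x_ix_k .$$ Let $P^{(j)}=\left(p^{(j)}_1,p^{(j)}_2,p^{(j)}_3\right)$, $j=1,2,3$, be three points of $D$ and let $G=\frac{P^{(1)}+P^{(2)}+P^{(3)}}{3}$ be their center of gravity. Then: 1) If $T(Hf)_P\leq 0$ for every $P\in D$, then $$f\left(P^{(1)}\right)+f\left(P^{(2)}\right)+f\left(P^{(3)}\right)\leq 3f(G).$$ 2) If $T(Hf)_P\geq 0$ for every $P\in D$, then $$f\left(P^{(1)}\right)+f\left(P^{(2)}\right)+f\left(P^{(3)}\right)\geq 3f(G).$$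
   Context: Here $T(Hf)_P\leq 0$ (respectively $T(Hf)_P\geq 0$) means that the quadratic form takes only values $\leq 0$ (respectively $\geq 0$) for all $(x_1,x_2,x_3)\in\mathbf{R}^3$; the subscript $P$ denotes evaluation of the second partial derivatives at the point $P$. A function is $C^{\infty}$ on $D$ if it is the restriction to $D$ of a $C^{\infty}$ function on an open set containing $D$, whose partial derivatives are the ones used. *)

theory Defs
  imports "HOL-Analysis.Analysis"
begin

definition partial_deriv :: "'n::finite \<Rightarrow> (real ^ 'n \<Rightarrow> real) \<Rightarrow> real ^ 'n \<Rightarrow> real" where
  "partial_deriv i F P = deriv (\<lambda>t. F (P + t *\<^sub>R axis i 1)) 0"

text \<open>The existence of the partial derivatives is required explicitly, because
  \<^const>\<open>deriv\<close> is a total function.\<close>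

fun C_k_on :: "nat \<Rightarrow> (real ^ 'n::finite \<Rightarrow> real) \<Rightarrow> (real ^ 'n) set \<Rightarrow> bool" where
  "C_k_on 0 F U \<longleftrightarrow> continuous_on U F"
| "C_k_on (Suc k) F U \<longleftrightarrow> continuous_on U F \<and>
     (\<forall>i. (\<forall>P\<in>U. (\<lambda>t. F (P + t *\<^sub>R axis i 1)) field_differentiable (at 0)) \<and>
          C_k_on k (partial_deriv i F) U)"

definition C_infinity_on :: "(real ^ 'n::finite \<Rightarrow> real) \<Rightarrow> (real ^ 'n) set \<Rightarrow> bool" where
  "C_infinity_on F U \<longleftrightarrow> (\<forall>k. C_k_on k F U)"

text \<open>\<open>f\<close> is smooth on the arbitrary set \<open>D\<close>, as witnessed by the smooth function \<open>F\<close>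
  on the open set \<open>U\<close>. The witness is kept as a parameter: when \<open>D\<close> has empty
  interior, \<open>f\<close> does not determine the partial derivatives of \<open>F\<close> at points of \<open>D\<close>.
  The values of \<open>f\<close> outside \<open>D\<close> and of \<open>F\<close> outside \<open>U\<close> are irrelevant.\<close>

definition smooth_extension ::
  "(real ^ 'n::finite) set \<Rightarrow> (real ^ 'n \<Rightarrow> real) \<Rightarrow> (real ^ 'n) set \<Rightarrow> (real ^ 'n \<Rightarrow> real) \<Rightarrow> bool" where
  "smooth_extension D f U F \<longleftrightarrow>
     open U \<and> D \<subseteq> U \<and> C_infinity_on F U \<and> (\<forall>P\<in>D. F P = f P)"

definition hessian_form :: "(real ^ 'n::finite \<Rightarrow> real) \<Rightarrow> real ^ 'n \<Rightarrow> real ^ 'n \<Rightarrow> real" where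
  "hessian_form F P x =
     (\<Sum>i\<in>UNIV. \<Sum>k\<in>UNIV. partial_deriv i (partial_deriv k F) P * (x $ i) * (x $ k))"

end

theory Submission
  imports Defs
begin

text \<open>The theorem is Jensen's inequality with equal weights. A semidefinite Hessian makes the
  function convex or concave on \<open>D\<close>, and convexity may be tested on the segments of \<open>D\<close>
  (\<open>convex_on_if_convex_on_segments\<close>). On the segment in direction \<open>v\<close> the second derivative of
  the function is the value at \<open>v\<close> of the Hessian form
  (\<open>C_2_on_line_second_deriv\<close>), so the sign criterion for real functions of one variable applies.

  Smoothness is defined through derivatives along the coordinate axes, whereas the segments have
  arbitrary directions. The link is the classical fact that continuous partial derivatives
  imply total differentiability (\<open>C_1_on_has_derivative\<close>), applied to \<open>F\<close> and then to each of its
  partial derivatives. It is proved for \<open>F\<close> on the open set \<open>U\<close>, because steps along the axes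
  may leave the segment and even \<open>D\<close>, which can have empty interior. Only points of \<open>D\<close> are
  needed once the derivatives along the segments are known.\<close>

section \<open>Continuous partial derivatives imply differentiability\<close>

lemma partial_deriv_along_axis:
  fixes F :: "real ^ 'n::finite \<Rightarrow> real"
  assumes "(\<lambda>t. F (P + s *\<^sub>R axis i 1 + t *\<^sub>R axis i 1)) field_differentiable (at 0)"
  shows "((\<lambda>t. F (P + t *\<^sub>R axis i 1)) has_field_derivative
            partial_deriv i F (P + s *\<^sub>R axis i 1)) (at s)"
proof -
  have eq: "(\<lambda>t. F (P + s *\<^sub>R axis i 1 + t *\<^sub>R axis i 1)) = (\<lambda>t. F (P + (t + s) *\<^sub>R axis i 1))"
    by (simp add: scaleR_add_left algebra_simps)
  have "((\<lambda>t. F (P + (t + s) *\<^sub>R axis i 1)) has_field_derivative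
            partial_deriv i F (P + s *\<^sub>R axis i 1)) (at 0)"
    using field_differentiable_derivI[OF assms] unfolding partial_deriv_def eq .
  then show ?thesis
    using DERIV_shift[of "\<lambda>t. F (P + t *\<^sub>R axis i 1)" _ 0 s] by simp
qed

text \<open>From \<open>P\<close> to \<open>P + h\<close> one moves along one coordinate axis at a time, and the mean value
  theorem bounds the error of each step by the oscillation of the partial derivative concerned.
  The induction adds one coordinate at a time; the intermediate points stay in the ball because
  deleting coordinates does not increase the norm.\<close>

lemma partial_derivs_linear_error:
  fixes F :: "real ^ 'n::finite \<Rightarrow> real"
  assumes diff: "\<And>i Q. Q \<in> ball P d \<Longrightarrow> (\<lambda>t. F (Q + t *\<^sub>R axis i 1)) field_differentiable (at 0)"
    and osc: "\<And>i Q. Q \<in> ball P d \<Longrightarrow> \<bar>partial_deriv i F Q - partial_deriv i F P\<bar> \<le> e"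
    and h: "norm h < d"
  shows "\<bar>F (P + (\<Sum>i\<in>S. (h $ i) *\<^sub>R axis i 1)) - F P - (\<Sum>i\<in>S. partial_deriv i F P * h $ i)\<bar>
           \<le> e * (\<Sum>i\<in>S. \<bar>h $ i\<bar>)"
proof (induction S rule: infinite_finite_induct)
  case (insert j S)
  define w where "w = (\<Sum>i\<in>S. (h $ i) *\<^sub>R (axis i 1 :: real ^ 'n))"
  define Q where "Q = P + w"
  have comp: "w $ k = (if k \<in> S then h $ k else 0)" for k
    using insert.hyps by (simp add: w_def axis_def if_distrib cong: if_cong)
  have ball: "Q + t *\<^sub>R axis j 1 \<in> ball P d" if t: "t \<in> closed_segment 0 (h $ j)" for t
  proof -
    have "\<bar>t\<bar> \<le> \<bar>h $ j\<bar>"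
      using t by (auto simp: closed_segment_eq_real_ivl split: if_splits)
    then have "norm (w + t *\<^sub>R axis j 1) \<le> norm h"
      using insert.hyps by (intro norm_le_componentwise_cart) (auto simp: comp axis_def)
    moreover have "dist (Q + t *\<^sub>R axis j 1) P = norm (w + t *\<^sub>R axis j 1)"
      by (simp add: Q_def dist_norm)
    ultimately show ?thesis
      using h by (simp add: dist_commute)
  qed
  have "norm ((F (Q + (h $ j) *\<^sub>R axis j 1) - partial_deriv j F P * h $ j)
              - (F (Q + 0 *\<^sub>R axis j 1) - partial_deriv j F P * 0)) \<le> e * norm (h $ j - 0)"
  proof (rule field_differentiable_bound[where S = "closed_segment 0 (h $ j)"
        and f' = "\<lambda>t. partial_deriv j F (Q + t *\<^sub>R axis j 1) - partial_deriv j F P"])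
    fix t assume t: "t \<in> closed_segment 0 (h $ j)"
    have "((\<lambda>t. F (Q + t *\<^sub>R axis j 1)) has_field_derivative
            partial_deriv j F (Q + t *\<^sub>R axis j 1)) (at t within closed_segment 0 (h $ j))"
      using partial_deriv_along_axis[OF diff[OF ball[OF t]]]
      by (rule has_field_derivative_at_within)
    then show "((\<lambda>t. F (Q + t *\<^sub>R axis j 1) - partial_deriv j F P * t) has_field_derivative
            partial_deriv j F (Q + t *\<^sub>R axis j 1) - partial_deriv j F P)
            (at t within closed_segment 0 (h $ j))"
      by (auto intro!: derivative_eq_intros)
    show "norm (partial_deriv j F (Q + t *\<^sub>R axis j 1) - partial_deriv j F P) \<le> e"
      using osc[OF ball[OF t]] by simp
  qed auto
  then have "\<bar>F (Q + (h $ j) *\<^sub>R axis j 1) - partial_deriv j F P * h $ j - F Q\<bar> \<le> e * \<bar>h $ j\<bar>"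
    by simp
  then show ?case
    using insert by (simp add: Q_def w_def algebra_simps)
qed auto

lemma C_1_on_has_derivative:
  fixes F :: "real ^ 'n::finite \<Rightarrow> real"
  assumes U: "open U" and P: "P \<in> U" and C1: "C_k_on 1 F U"
  shows "(F has_derivative (\<lambda>h. \<Sum>i\<in>UNIV. partial_deriv i F P * h $ i)) (at P)"
  unfolding has_derivative_at_alt
proof (intro conjI allI impI)
  show "bounded_linear (\<lambda>h. \<Sum>i\<in>UNIV. partial_deriv i F P * h $ i)"
    by (intro bounded_linear_sum bounded_linear_mult_right[THEN bounded_linear_compose]
        bounded_linear_vec_nth)
  fix e :: real assume e: "0 < e"
  \<comment> \<open>The error lemma measures \<open>h\<close> by the sum of the absolute values of its coordinates, which is
    at most \<open>CARD('n)\<close> times its Euclidean norm.\<close>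
  define c where "c = e / real CARD('n)"
  have c: "0 < c" using e by (simp add: c_def)
  have "\<exists>d>0. ball P d \<subseteq> U \<and> (\<forall>i. \<forall>Q\<in>ball P d. \<bar>partial_deriv i F Q - partial_deriv i F P\<bar> \<le> c)"
  proof -
    have "\<forall>\<^sub>F Q in nhds P. Q \<in> U \<and> (\<forall>i. dist (partial_deriv i F Q) (partial_deriv i F P) < c)"
    proof (intro eventually_conj eventually_all_finite)
      show "\<forall>\<^sub>F Q in nhds P. Q \<in> U"
        using U P by (rule eventually_nhds_in_open)
      fix i
      have "continuous_on U (partial_deriv i F)"
        using C1 by (simp add: numeral_eq_Suc)
      then have "isCont (partial_deriv i F) P"
        using U P by (simp add: continuous_on_eq_continuous_at)
      then have "(partial_deriv i F \<longlongrightarrow> partial_deriv i F P) (nhds P)"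
        by (simp add: continuous_at tendsto_at_iff_tendsto_nhds)
      then show "\<forall>\<^sub>F Q in nhds P. dist (partial_deriv i F Q) (partial_deriv i F P) < c"
        using c by (rule tendstoD)
    qed
    then show ?thesis
      unfolding eventually_nhds_metric
      by (fastforce simp: dist_real_def dist_commute subset_iff intro: less_imp_le)
  qed
  then obtain d where d: "0 < d" "ball P d \<subseteq> U"
    "\<And>i Q. Q \<in> ball P d \<Longrightarrow> \<bar>partial_deriv i F Q - partial_deriv i F P\<bar> \<le> c"
    by blast
  have "norm (F y - F P - (\<Sum>i\<in>UNIV. partial_deriv i F P * (y - P) $ i)) \<le> e * norm (y - P)"
    if y: "norm (y - P) < d" for y
  proof -
    have expand: "(\<Sum>i\<in>UNIV. ((y - P) $ i) *\<^sub>R axis i 1) = y - P"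
      using basis_expansion[of "y - P"] by (simp add: scalar_mult_eq_scaleR)
    have "\<bar>F (P + (\<Sum>i\<in>UNIV. ((y - P) $ i) *\<^sub>R axis i 1)) - F P
            - (\<Sum>i\<in>UNIV. partial_deriv i F P * (y - P) $ i)\<bar> \<le> c * (\<Sum>i\<in>UNIV. \<bar>(y - P) $ i\<bar>)"
      using d C1 y by (intro partial_derivs_linear_error[where d = d]) auto
    also have "c * (\<Sum>i\<in>UNIV. \<bar>(y - P) $ i\<bar>) \<le> c * (\<Sum>i\<in>(UNIV::'n set). norm (y - P))"
      using c by (intro mult_left_mono sum_mono component_le_norm_cart) auto
    also have "\<dots> = e * norm (y - P)"
      by (simp add: c_def)
    finally show ?thesis
      unfolding expand by simp
  qed
  then show "\<exists>d>0. \<forall>y. norm (y - P) < d \<longrightarrow>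
      norm (F y - F P - (\<Sum>i\<in>UNIV. partial_deriv i F P * (y - P) $ i)) \<le> e * norm (y - P)"
    using d(1) by blast
qed

section \<open>Derivatives along a line\<close>

lemma C_1_on_line_deriv:
  fixes F :: "real ^ 'n::finite \<Rightarrow> real"
  assumes "open U" "A + t *\<^sub>R v \<in> U" "C_k_on 1 F U"
  shows "((\<lambda>t. F (A + t *\<^sub>R v)) has_real_derivative
            (\<Sum>i\<in>UNIV. partial_deriv i F (A + t *\<^sub>R v) * v $ i)) (at t)"
proof -
  have "((\<lambda>t. A + t *\<^sub>R v) has_derivative (\<lambda>s. s *\<^sub>R v)) (at t)"
    by (auto intro!: derivative_eq_intros)
  from has_derivative_compose[OF this C_1_on_has_derivative[OF assms]] show ?thesis
    unfolding has_field_derivative_def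
    by (rule has_derivative_eq_rhs) (auto simp: sum_distrib_left mult_ac)
qed

lemma C_2_on_line_second_deriv:
  fixes F :: "real ^ 'n::finite \<Rightarrow> real"
  assumes "open U" "A + t *\<^sub>R v \<in> U" "C_k_on 2 F U"
  shows "((\<lambda>t. \<Sum>k\<in>UNIV. partial_deriv k F (A + t *\<^sub>R v) * v $ k) has_real_derivative
            hessian_form F (A + t *\<^sub>R v) v) (at t)"
proof -
  have "C_k_on 1 (partial_deriv k F) U" for k
    using assms(3) by (simp add: numeral_2_eq_2)
  then have "((\<lambda>t. \<Sum>k\<in>UNIV. partial_deriv k F (A + t *\<^sub>R v) * v $ k) has_real_derivative
      (\<Sum>k\<in>UNIV. (\<Sum>i\<in>UNIV. partial_deriv i (partial_deriv k F) (A + t *\<^sub>R v) * v $ i) * v $ k)) (at t)"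
    using assms by (intro DERIV_sum DERIV_cmult_right C_1_on_line_deriv)
  also have "(\<Sum>k\<in>UNIV. (\<Sum>i\<in>UNIV. partial_deriv i (partial_deriv k F) (A + t *\<^sub>R v) * v $ i) * v $ k)
      = hessian_form F (A + t *\<^sub>R v) v"
    unfolding hessian_form_def sum_distrib_right by (rule sum.swap)
  finally show ?thesis .
qed

section \<open>Semidefinite Hessian and convexity\<close>

lemma convex_on_if_convex_on_segments:
  fixes f :: "'a::real_vector \<Rightarrow> real"
  assumes "convex D"
    and seg: "\<And>A B. A \<in> D \<Longrightarrow> B \<in> D \<Longrightarrow> convex_on {0..1} (\<lambda>t. f (A + t *\<^sub>R (B - A)))"
  shows "convex_on D f"
proof (rule convex_onI)
  fix t :: real and A B assume "0 < t" "t < 1" and AB: "A \<in> D" "B \<in> D"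
  then have "f (A + ((1 - t) *\<^sub>R 0 + t *\<^sub>R 1) *\<^sub>R (B - A))
      \<le> (1 - t) * f (A + 0 *\<^sub>R (B - A)) + t * f (A + 1 *\<^sub>R (B - A))"
    by (intro convex_onD[OF seg]) auto
  then show "f ((1 - t) *\<^sub>R A + t *\<^sub>R B) \<le> (1 - t) * f A + t * f B"
    by (simp add: algebra_simps)
qed fact

lemma line_in_convex:
  assumes "convex D" "A \<in> D" "B \<in> D" "t \<in> {0..1}"
  shows "A + t *\<^sub>R (B - A) \<in> D"
  using convexD_alt[OF assms(1-3), of t] assms(4) by (simp add: algebra_simps)

lemma hessian_form_nonneg_imp_convex_on:
  assumes D: "convex D" "D \<subseteq> U" "open U" and C2: "C_k_on 2 F U"
    and pos: "\<And>P x. P \<in> D \<Longrightarrow> hessian_form F P x \<ge> 0"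
  shows "convex_on D F"
proof (rule convex_on_if_convex_on_segments[OF D(1)])
  fix A B assume AB: "A \<in> D" "B \<in> D"
  have C1: "C_k_on 1 F U" using C2 by (auto simp: numeral_2_eq_2)
  note inD = line_in_convex[OF D(1) AB]
  show "convex_on {0..1} (\<lambda>t. F (A + t *\<^sub>R (B - A)))"
    by (rule f''_ge0_imp_convex[OF _ C_1_on_line_deriv[OF D(3) _ C1] C_2_on_line_second_deriv[OF D(3) _ C2]])
       (use D(2) inD pos in auto)
qed

text \<open>The sign criterion for concavity is applied on the segments, after \<open>F\<close> has been reduced to
  one variable; so the partial derivatives of \<open>- F\<close> need not be computed.\<close>

lemma hessian_form_nonpos_imp_concave_on:
  assumes D: "convex D" "D \<subseteq> U" "open U" and C2: "C_k_on 2 F U"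
    and neg: "\<And>P x. P \<in> D \<Longrightarrow> hessian_form F P x \<le> 0"
  shows "concave_on D F"
  unfolding concave_on_def
proof (rule convex_on_if_convex_on_segments[OF D(1)])
  fix A B assume AB: "A \<in> D" "B \<in> D"
  have C1: "C_k_on 1 F U" using C2 by (auto simp: numeral_2_eq_2)
  note inD = line_in_convex[OF D(1) AB]
  show "convex_on {0..1} (\<lambda>t. - F (A + t *\<^sub>R (B - A)))"
    unfolding concave_on_def[symmetric]
    by (rule f''_le0_imp_concave[OF _ C_1_on_line_deriv[OF D(3) _ C1] C_2_on_line_second_deriv[OF D(3) _ C2]])
       (use D(2) inD neg in auto)
qed

lemma convex_on_centroid:
  assumes f: "convex_on D f" and P: "P1 \<in> D" "P2 \<in> D" "P3 \<in> D"
  shows "3 * f ((1 / 3) *\<^sub>R (P1 + P2 + P3)) \<le> f P1 + f P2 + f P3"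
proof -
  have "f (\<Sum>j\<in>{0,1,2::nat}. (1/3) *\<^sub>R [P1, P2, P3] ! j) \<le> (\<Sum>j\<in>{0,1,2::nat}. 1/3 * f ([P1, P2, P3] ! j))"
    using P by (intro convex_on_sum[OF _ _ f]) auto
  then show ?thesis
    by (simp add: scaleR_add_right algebra_simps)
qed

theorem mainTheorem1:
  fixes D U :: "(real ^ 3) set"
    and f F :: "real ^ 3 \<Rightarrow> real"
    and P1 P2 P3 G :: "real ^ 3"
  assumes "convex D"
    and "smooth_extension D f U F"
    and "P1 \<in> D" and "P2 \<in> D" and "P3 \<in> D"
    and "G = (1 / 3) *\<^sub>R (P1 + P2 + P3)"
  shows "((\<forall>P\<in>D. \<forall>x. hessian_form F P x \<le> 0) \<longrightarrow> f P1 + f P2 + f P3 \<le> 3 * f G) \<and>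
         ((\<forall>P\<in>D. \<forall>x. hessian_form F P x \<ge> 0) \<longrightarrow> f P1 + f P2 + f P3 \<ge> 3 * f G)"
proof -
  have U: "open U" "D \<subseteq> U" and C2: "C_k_on 2 F U" and fF: "\<And>P. P \<in> D \<Longrightarrow> f P = F P"
    using assms(2) unfolding smooth_extension_def C_infinity_on_def by auto
  have "(1/3) *\<^sub>R P1 + (1/3) *\<^sub>R P2 + (1/3) *\<^sub>R P3 \<in> convex hull {P1, P2, P3}"
    unfolding convex_hull_3 by force
  then have "(1/3) *\<^sub>R P1 + (1/3) *\<^sub>R P2 + (1/3) *\<^sub>R P3 \<in> D"
    using hull_minimal[of "{P1, P2, P3}" D convex] assms(1,3-5) by auto
  then have "G \<in> D"
    by (simp add: assms(6) scaleR_add_right)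
  note eqs = fF[OF assms(3)] fF[OF assms(4)] fF[OF assms(5)] fF[OF this]
  show ?thesis
  proof (intro conjI impI)
    assume "\<forall>P\<in>D. \<forall>x. hessian_form F P x \<le> 0"
    then have "convex_on D (\<lambda>P. - F P)"
      using hessian_form_nonpos_imp_concave_on[OF assms(1) U(2,1) C2]
      by (simp add: concave_on_def)
    from convex_on_centroid[OF this assms(3-5), folded assms(6)] show "f P1 + f P2 + f P3 \<le> 3 * f G"
      unfolding eqs by simp
  next
    assume "\<forall>P\<in>D. \<forall>x. hessian_form F P x \<ge> 0"
    then have "convex_on D F"
      using hessian_form_nonneg_imp_convex_on[OF assms(1) U(2,1) C2] by blast
    from convex_on_centroid[OF this assms(3-5), folded assms(6)] show "f P1 + f P2 + f P3 \<ge> 3 * f G"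
      unfolding eqs by simp
  qed
qed

end
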